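(* Let $G_1,G_2$ be finite groups. The partial order $\leq$ (inclusion) on the set $\mathcal{S}_{G_1\times G_2}$ of subgroups of $G_1\times G_2$ is a product of three relations: $${\leq}={\leq_K}\circ{\leq_{P/K}}\circ{\leq_P}.$$ Moreover, if $A(R)$ denotes the incidence matrix of the relation $R$, the stronger property $$A(\leq)=A(\leq_K)\cdot A(\leq_{P/K})\cdot A(\leq_P)$$ also holds.
   Context: A section of a group $G$ is a pair $(P,K)$ of subgroups with $K\trianglelefteq P$. By Goursat's Lemma, subgroups $L$ of $G_1\times G_2$ correspond bijectively to isomorphisms $\theta\colon P_1/K_1\to P_2/K_2$ with $(P_i,K_i)$ a section of $G_i$, where $L=\{(a_1,a_2)\in P_1\times P_2 : \theta(a_1K_1)=a_2K_2\}$; we write $L=(\theta\colon P_1/K_1\to P_2/K_2)$. Here $P_i$ is the projection of $L$ to $G_i$ and $K_1=\{a_1:(a_1,1)\in L\}$, $K_2=\{a_2:(1,a_2)\in L\}$. For subgroups $L=(\theta\colon P_1/K_1\to P_2/K_2)$ and $L'=(\theta'\colon P_1'/K_1'\to P_2'/K_2')$ of $G_1\times G_2$ with $L'\leq L$ one has $P_i'\leq P_i$ and $K_i'\leq K_i$, $i=1,2$, and one writes: $L'\leq_P L$ if $P_i'=P_i$ for $i=1,2$; $L'\leq_K L$ if $K_i'=K_i$ for $i=1,2$; $L'\leq_{P/K}L$ if the canonical homomorphisms $P_i'/K_i'\to P_i/K_i$, $pK_i'\mapsto pK_i$, are isomorphisms for $i=1,2$. These three relations are partial orders. (The subscripts $P$,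 $K$, $P/K$ are just names of the relations.) The relation product of $R\subseteq X\times Y$ and $S\subseteq Y\times Z$ is $S\circ R=\{(x,z) : (x,y)\in R \text{ and } (y,z)\in S \text{ for some } y\in Y\}$. The incidence matrix of a finite poset $(X,\leq)$ is $A(\leq)=(a_{xy})_{x,y\in X}$ with $a_{xy}=1$ if $y\leq x$ and $a_{xy}=0$ otherwise. *)

theory Defs
  imports "HOL-Algebra.Coset" "Jordan_Normal_Form.Matrix"
begin

definition subgroups_of :: "('a, 'm) monoid_scheme \<Rightarrow> 'a set set" where
  "subgroups_of G = {H. subgroup H G}"

text \<open>
  A subgroup \<open>L\<close> of \<open>G1 \<times>\<times> G2\<close> corresponds under Goursat's Lemma to an isomorphism
  \<open>P1/K1 \<rightarrow> P2/K2\<close> between sections of \<open>G1\<close> and \<open>G2\<close>, where \<open>Pi\<close> and \<open>Ki\<close> are as follows.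
\<close>

definition goursat_P1 :: "('a \<times> 'b) set \<Rightarrow> 'a set" where
  "goursat_P1 L = fst ` L"

definition goursat_P2 :: "('a \<times> 'b) set \<Rightarrow> 'b set" where
  "goursat_P2 L = snd ` L"

definition goursat_K1 :: "('b, 'n) monoid_scheme \<Rightarrow> ('a \<times> 'b) set \<Rightarrow> 'a set" where
  "goursat_K1 G2 L = {a. (a, \<one>\<^bsub>G2\<^esub>) \<in> L}"

definition goursat_K2 :: "('a, 'm) monoid_scheme \<Rightarrow> ('a \<times> 'b) set \<Rightarrow> 'b set" where
  "goursat_K2 G1 L = {b. (\<one>\<^bsub>G1\<^esub>, b) \<in> L}"

definition section_quotient ::
    "('a, 'm) monoid_scheme \<Rightarrow> 'a set \<Rightarrow> 'a set \<Rightarrow> 'a set monoid" where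
  "section_quotient G P K = (G\<lparr>carrier := P\<rparr>) Mod K"

text \<open>
  The canonical map \<open>P'/K' \<rightarrow> P/K\<close>, \<open>pK' \<mapsto> pK\<close>, for sections with \<open>P' \<subseteq> P\<close> and \<open>K' \<subseteq> K\<close>:
  a coset \<open>C\<close> of \<open>K'\<close> is sent to the common coset of \<open>K\<close> of its elements. As in the
  library's quotient groups, cosets are written as right cosets; by normality
  they agree with the left ones.
\<close>

definition canonical_section_map ::
    "('a, 'm) monoid_scheme \<Rightarrow> 'a set \<Rightarrow> 'a set \<Rightarrow> 'a set" where
  "canonical_section_map G K C = the_elem ((\<lambda>p. K #>\<^bsub>G\<^esub> p) ` C)"

lemma canonical_section_map_coset:
  assumes "group G" "subgroup K' G" "subgroup K G" "K' \<subseteq> K" "p \<in> carrier G"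
  shows "canonical_section_map G K (K' #>\<^bsub>G\<^esub> p) = K #>\<^bsub>G\<^esub> p"
proof -
  interpret group G by fact
  have K: "K \<subseteq> carrier G"
    by (rule subgroup.subset[OF assms(3)])
  have "K #>\<^bsub>G\<^esub> (k \<otimes>\<^bsub>G\<^esub> p) = K #>\<^bsub>G\<^esub> p" if "k \<in> K'" for k
  proof -
    have k: "k \<in> K" "k \<in> carrier G" using that assms(4) K by auto
    have "K #>\<^bsub>G\<^esub> (k \<otimes>\<^bsub>G\<^esub> p) = (K #>\<^bsub>G\<^esub> k) #>\<^bsub>G\<^esub> p"
      using coset_mult_assoc[OF K k(2) assms(5)] by simp
    also have "K #>\<^bsub>G\<^esub> k = K"
      using coset_join2[OF k(2) assms(3) k(1)] .
    finally show ?thesis .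
  qed
  moreover have "\<one>\<^bsub>G\<^esub> \<in> K'"
    by (rule subgroup.one_closed[OF assms(2)])
  ultimately have "(\<lambda>x. K #>\<^bsub>G\<^esub> x) ` (K' #>\<^bsub>G\<^esub> p) = {K #>\<^bsub>G\<^esub> p}"
    unfolding r_coset_def[of G K' p] by (auto simp: image_iff)
  then show ?thesis
    by (simp add: canonical_section_map_def)
qed

text \<open>
  The relations are sets of pairs \<open>(L', L)\<close> with the smaller subgroup first.
\<close>

definition sub_le ::
    "('a, 'm) monoid_scheme \<Rightarrow> ('b, 'n) monoid_scheme \<Rightarrow> ('a \<times> 'b) set rel" where
  "sub_le G1 G2 = {(L', L). L' \<in> subgroups_of (G1 \<times>\<times> G2) \<and>
     L \<in> subgroups_of (G1 \<times>\<times> G2) \<and> L' \<subseteq> L}"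

definition sub_le_P ::
    "('a, 'm) monoid_scheme \<Rightarrow> ('b, 'n) monoid_scheme \<Rightarrow> ('a \<times> 'b) set rel" where
  "sub_le_P G1 G2 = {(L', L). (L', L) \<in> sub_le G1 G2 \<and>
     goursat_P1 L' = goursat_P1 L \<and> goursat_P2 L' = goursat_P2 L}"

definition sub_le_K ::
    "('a, 'm) monoid_scheme \<Rightarrow> ('b, 'n) monoid_scheme \<Rightarrow> ('a \<times> 'b) set rel" where
  "sub_le_K G1 G2 = {(L', L). (L', L) \<in> sub_le G1 G2 \<and>
     goursat_K1 G2 L' = goursat_K1 G2 L \<and> goursat_K2 G1 L' = goursat_K2 G1 L}"

definition sub_le_PK ::
    "('a, 'm) monoid_scheme \<Rightarrow> ('b, 'n) monoid_scheme \<Rightarrow> ('a \<times> 'b) set rel" where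
  "sub_le_PK G1 G2 = {(L', L). (L', L) \<in> sub_le G1 G2 \<and>
     canonical_section_map G1 (goursat_K1 G2 L)
       \<in> iso (section_quotient G1 (goursat_P1 L') (goursat_K1 G2 L'))
             (section_quotient G1 (goursat_P1 L) (goursat_K1 G2 L)) \<and>
     canonical_section_map G2 (goursat_K2 G1 L)
       \<in> iso (section_quotient G2 (goursat_P2 L') (goursat_K2 G1 L'))
             (section_quotient G2 (goursat_P2 L) (goursat_K2 G1 L))}"

text \<open>
  The relation product \<open>S \<circ> R\<close>, in the order of function composition: first \<open>R\<close>, then \<open>S\<close>.
  The library's \<open>O\<close> takes its arguments in the opposite order.
\<close>

definition rel_product :: "('b \<times> 'c) set \<Rightarrow> ('a \<times> 'b) set \<Rightarrow> ('a \<times> 'c) set"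
    (infixl \<open>\<circ>\<^sub>R\<close> 75) where
  "S \<circ>\<^sub>R R = R O S"

text \<open>
  The incidence matrix of a relation on a finite set \<open>X\<close>, whose rows and columns are ordered
  by an enumeration \<open>xs\<close> of \<open>X\<close> without repetitions. The entry in row \<open>x\<close> and column \<open>y\<close>
  is 1 iff \<open>y\<close> is related to \<open>x\<close>, that is, iff \<open>y \<le> x\<close>.
\<close>

definition incidence_matrix :: "'a list \<Rightarrow> 'a rel \<Rightarrow> int mat" where
  "incidence_matrix xs R =
     mat (length xs) (length xs) (\<lambda>(i, j). if (xs ! j, xs ! i) \<in> R then 1 else 0)"

end

theory Submission
  imports Defs "HOL-Algebra.Zassenhaus"
begin

text \<open>
  If \<open>L' \<le> L\<close> with associated sections \<open>(Pi', Ki')\<close> and \<open>(Pi, Ki)\<close>, then \<open>L' \<le>\<^bsub>P/K\<^esub> L\<close> says that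
  \<open>Ki' = Pi' \<inter> Ki\<close> and \<open>Pi = Ki Pi'\<close>. Hence in a chain \<open>L' \<le>\<^sub>P M \<le>\<^bsub>P/K\<^esub> N \<le>\<^sub>K L\<close> the sections of \<open>N\<close> are
  \<open>(Ki Pi', Ki)\<close> and those of \<open>M\<close> are \<open>(Pi', Pi' \<inter> Ki)\<close>. Nested subgroups with the same \<open>P1\<close> and
  the same \<open>K2\<close> coincide, so the only candidates are \<open>N = (K1 \<times> K2) L'\<close> and
  \<open>M = N \<inter> (P1' \<times> P2')\<close>, and these work. As the intermediate subgroups are unique,
  every entry of the product of incidence matrices counts at most one chain.
\<close>

section \<open>Incidence matrices and relation products\<close>

text \<open>Entry (i, j) of the product counts the elements of \<open>xs\<close> lying between
  \<open>xs ! j\<close> and \<open>xs ! i\<close>. By \<open>middle\<close> no intermediate element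
  is missed, and by \<open>unique\<close> the count is 0 or 1, so it is an incidence entry.\<close>

lemma incidence_matrix_relcomp:
  assumes "distinct xs"
    and middle: "\<And>x y z. (x, y) \<in> R \<Longrightarrow> (y, z) \<in> S \<Longrightarrow> y \<in> set xs"
    and unique: "\<And>x y y' z. \<lbrakk>(x, y) \<in> R; (y, z) \<in> S; (x, y') \<in> R; (y', z) \<in> S\<rbrakk> \<Longrightarrow> y = y'"
  shows "incidence_matrix xs S * incidence_matrix xs R = incidence_matrix xs (R O S)"
proof (rule eq_matI)
  fix i j
  assume "i < dim_row (incidence_matrix xs (R O S))" "j < dim_col (incidence_matrix xs (R O S))"
  then have ij: "i < length xs" "j < length xs"
    by (auto simp: incidence_matrix_def)
  let ?chain = "\<lambda>k. (xs ! j, xs ! k) \<in> R \<and> (xs ! k, xs ! i) \<in> S"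
  have "(incidence_matrix xs S * incidence_matrix xs R) $$ (i, j) =
      (\<Sum>k<length xs. if ?chain k then 1 else 0)"
    using ij unfolding incidence_matrix_def
    by (auto simp: scalar_prod_def atLeast0LessThan intro!: sum.cong)
  also have "\<dots> = (if (xs ! j, xs ! i) \<in> R O S then 1 else 0)"
  proof (cases "(xs ! j, xs ! i) \<in> R O S")
    case True
    then obtain y where y: "(xs ! j, y) \<in> R" "(y, xs ! i) \<in> S"
      by blast
    with middle obtain k where k: "k < length xs" "xs ! k = y"
      by (metis in_set_conv_nth)
    \<comment> \<open>Since \<open>xs\<close> has no repetitions, the unique intermediate element
      occurs at a single index.\<close>
    have "?chain l \<longleftrightarrow> l = k" if "l < length xs" for l
      using unique[OF _ _ y] y k that \<open>distinct xs\<close> by (metis nth_eq_iff_index_eq)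
    then have "(\<Sum>l<length xs. if ?chain l then 1 else 0 :: int) =
        (\<Sum>l<length xs. if l = k then 1 else 0)"
      by (intro sum.cong) auto
    then show ?thesis
      using True k by simp
  next
    case False
    then have "\<not> ?chain k" for k
      by blast
    then have "(\<Sum>k<length xs. if ?chain k then 1 else 0 :: int) = 0"
      by (intro sum.neutral) simp
    then show ?thesis
      using False by simp
  qed
  finally show "(incidence_matrix xs S * incidence_matrix xs R) $$ (i, j) =
      incidence_matrix xs (R O S) $$ (i, j)"
    using ij by (simp add: incidence_matrix_def)
qed (auto simp: incidence_matrix_def)

section \<open>The canonical map between sections\<close>

lemma (in group) rcos_eq_iff:
  assumes "subgroup H G" "a \<in> carrier G" "b \<in> carrier G"
  shows "H #> a = H #> b \<longleftrightarrow> a \<otimes> inv b \<in> H"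
proof
  assume "H #> a = H #> b"
  then have "a \<in> H #> b"
    using assms rcos_self by blast
  then show "a \<otimes> inv b \<in> H"
    using assms by (auto simp: r_coset_def m_assoc subgroup.mem_carrier)
next
  assume *: "a \<otimes> inv b \<in> H"
  have "a = (a \<otimes> inv b) \<otimes> b"
    using assms by (simp add: m_assoc)
  then have "a \<in> H #> b"
    using * by (auto simp: r_coset_def)
  then show "H #> a = H #> b"
    using assms repr_independence by metis
qed

lemma carrier_section_quotient:
  "carrier (section_quotient G P K) = (\<lambda>p. K #>\<^bsub>G\<^esub> p) ` P"
  by (simp add: section_quotient_def carrier_FactGroup)

lemma mult_section_quotient:
  assumes "K \<lhd> G\<lparr>carrier := P\<rparr>" "a \<in> P" "b \<in> P"
  shows "(K #>\<^bsub>G\<^esub> a) \<otimes>\<^bsub>section_quotient G P K\<^esub> (K #>\<^bsub>G\<^esub> b) = K #>\<^bsub>G\<^esub> (a \<otimes>\<^bsub>G\<^esub> b)"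
  using normal.rcos_sum[OF assms(1), of a b] assms by (simp add: section_quotient_def)

text \<open>The canonical map is always a homomorphism. Its kernel consists of the cosets of
  elements of \<open>P' \<inter> K\<close>, and its image is \<open>K P'\<close> modulo
  \<open>K\<close>. Hence the first inclusion is injectivity and the second surjectivity; the
  reverse inclusions hold automatically.\<close>

lemma (in group) canonical_section_map_iso_iff:
  assumes P': "subgroup P' G" and P: "subgroup P G" "P' \<subseteq> P"
    and K': "K' \<lhd> G\<lparr>carrier := P'\<rparr>" and K: "K \<lhd> G\<lparr>carrier := P\<rparr>" "K' \<subseteq> K"
  shows "canonical_section_map G K \<in> iso (section_quotient G P' K') (section_quotient G P K)
    \<longleftrightarrow> P' \<inter> K \<subseteq> K' \<and> P \<subseteq> K <#> P'"
proof -
  have K'G: "subgroup K' G" and KG: "subgroup K G"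
    using incl_subgroup[OF P' normal_imp_subgroup[OF K']]
      incl_subgroup[OF P(1) normal_imp_subgroup[OF K(1)]] by auto
  have P'c: "x \<in> carrier G" if "x \<in> P'" for x
    using that P' subgroup.mem_carrier by metis
  have Pc: "x \<in> carrier G" if "x \<in> P" for x
    using that P(1) subgroup.mem_carrier by metis
  have map: "canonical_section_map G K (K' #> p) = K #> p" if "p \<in> P'" for p
    using canonical_section_map_coset[OF group_axioms K'G KG K(2)] that P'c by blast
  have hom: "canonical_section_map G K \<in> hom (section_quotient G P' K') (section_quotient G P K)"
    using P(2) subgroup.m_closed[OF P']
    by (auto simp: hom_def carrier_section_quotient map mult_section_quotient[OF K']
        mult_section_quotient[OF K(1)] subsetD)
  have inj: "inj_on (canonical_section_map G K) (carrier (section_quotient G P' K'))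
      \<longleftrightarrow> P' \<inter> K \<subseteq> K'"
  proof
    assume inj: "inj_on (canonical_section_map G K) (carrier (section_quotient G P' K'))"
    show "P' \<inter> K \<subseteq> K'"
    proof
      fix x assume x: "x \<in> P' \<inter> K"
      have one: "\<one> \<in> P'"
        using P' subgroup.one_closed by blast
      have "K #> x = K #> \<one>"
        using x KG P'c rcos_eq_iff[OF KG, of x \<one>] by simp
      then have "K' #> x = K' #> \<one>"
        using inj_onD[OF inj, of "K' #> x" "K' #> \<one>"] x one map
        by (auto simp: carrier_section_quotient)
      then show "x \<in> K'"
        using x P'c rcos_eq_iff[OF K'G, of x \<one>] by simp
    qed
  next
    assume sub: "P' \<inter> K \<subseteq> K'"
    show "inj_on (canonical_section_map G K) (carrier (section_quotient G P' K'))"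
    proof (rule inj_onI, clarsimp simp: carrier_section_quotient map)
      fix a b assume ab: "a \<in> P'" "b \<in> P'" "K #> a = K #> b"
      then have "a \<otimes> inv b \<in> P' \<inter> K"
        using rcos_eq_iff[OF KG] P'c P' by (simp add: subgroup.m_closed subgroup.m_inv_closed)
      then show "K' #> a = K' #> b"
        using sub ab rcos_eq_iff[OF K'G] P'c by blast
    qed
  qed
  have surj: "canonical_section_map G K ` carrier (section_quotient G P' K')
      = carrier (section_quotient G P K) \<longleftrightarrow> P \<subseteq> K <#> P'"
  proof -
    have image: "canonical_section_map G K ` carrier (section_quotient G P' K')
        = (\<lambda>p. K #> p) ` P'"
      by (force simp: carrier_section_quotient map)
    \<comment> \<open>One inclusion of the images is free because
      \<open>P' \<subseteq> P\<close>.\<close>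
    have "canonical_section_map G K ` carrier (section_quotient G P' K')
        = carrier (section_quotient G P K) \<longleftrightarrow> (\<lambda>p. K #> p) ` P \<subseteq> (\<lambda>p. K #> p) ` P'"
      using image_mono[OF P(2), of "\<lambda>p. K #> p"] unfolding image
      unfolding carrier_section_quotient by auto
    also have "\<dots> \<longleftrightarrow> (\<forall>p\<in>P. \<exists>q\<in>P'. K #> p = K #> q)"
      by (simp add: image_subset_iff image_iff)
    also have "\<dots> \<longleftrightarrow> P \<subseteq> K <#> P'"
    proof -
      have "K #> p = K #> q \<longleftrightarrow> p \<in> K #> q" if "p \<in> P" "q \<in> P'" for p q
        using that Pc P'c repr_independence[OF _ _ KG] repr_independenceD[OF KG] by metis
      then have "K #> p = K #> q \<longleftrightarrow> (\<exists>k\<in>K. p = k \<otimes> q)" if "p \<in> P" "q \<in> P'" for p q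
        using that unfolding r_coset_def by simp
      then have "(\<forall>p\<in>P. \<exists>q\<in>P'. K #> p = K #> q) \<longleftrightarrow> (\<forall>p\<in>P. \<exists>q\<in>P'. \<exists>k\<in>K. p = k \<otimes> q)"
        by (intro ball_cong bex_cong refl)
      also have "\<dots> \<longleftrightarrow> P \<subseteq> K <#> P'"
        unfolding set_mult_def by blast
      finally show ?thesis .
    qed
    finally show ?thesis .
  qed
  show ?thesis
    using hom inj surj by (simp add: iso_def bij_betw_def)
qed

section \<open>Sections of subgroups of a direct product\<close>

locale group_pair = G1: group G1 + G2: group G2
  for G1 :: "('a, 'm) monoid_scheme" and G2 :: "('b, 'n) monoid_scheme"
begin

abbreviation "K1 \<equiv> goursat_K1 G2"
abbreviation "K2 \<equiv> goursat_K2 G1"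
abbreviation "P1 \<equiv> goursat_P1"
abbreviation "P2 \<equiv> goursat_P2"

lemmas goursat_defs = goursat_P1_def goursat_P2_def goursat_K1_def goursat_K2_def

sublocale G12: group "G1 \<times>\<times> G2"
  by (rule DirProd_group) (rule G1.group_axioms G2.group_axioms)+

section \<open>Projections and kernels of a single subgroup\<close>

context
  fixes L assumes L: "subgroup L (G1 \<times>\<times> G2)"
begin

lemma mem_carrier:
  assumes "(a, b) \<in> L"
  shows "a \<in> carrier G1" "b \<in> carrier G2"
  using subgroup.mem_carrier[OF L assms] by auto

lemma one_mem: "(\<one>\<^bsub>G1\<^esub>, \<one>\<^bsub>G2\<^esub>) \<in> L"
  using subgroup.one_closed[OF L] by simp

lemma mult_mem: "(a, b) \<in> L \<Longrightarrow> (c, d) \<in> L \<Longrightarrow> (a \<otimes>\<^bsub>G1\<^esub> c, b \<otimes>\<^bsub>G2\<^esub> d) \<in> L"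
  using subgroup.m_closed[OF L, of "(a, b)" "(c, d)"] by simp

lemma inv_mem: "(a, b) \<in> L \<Longrightarrow> (inv\<^bsub>G1\<^esub> a, inv\<^bsub>G2\<^esub> b) \<in> L"
  using subgroup.m_inv_closed[OF L, of "(a, b)"] mem_carrier
  by (simp add: inv_DirProd[OF G1.group_axioms G2.group_axioms])

lemma subgroup_P1: "subgroup (P1 L) G1"
proof -
  interpret group_hom "G1 \<times>\<times> G2" G1 fst
    by unfold_locales (auto simp: hom_def)
  show ?thesis
    unfolding goursat_P1_def by (rule subgroup_img_is_subgroup[OF L])
qed

lemma subgroup_P2: "subgroup (P2 L) G2"
proof -
  interpret group_hom "G1 \<times>\<times> G2" G2 snd
    by unfold_locales (auto simp: hom_def)
  show ?thesis
    unfolding goursat_P2_def by (rule subgroup_img_is_subgroup[OF L])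
qed

lemma subgroup_K1: "subgroup (K1 L) G1"
proof (rule G1.subgroupI)
  show "K1 L \<subseteq> carrier G1"
    using mem_carrier by (auto simp: goursat_K1_def)
  show "K1 L \<noteq> {}"
    using one_mem by (auto simp: goursat_K1_def)
  fix a assume "a \<in> K1 L"
  then have a: "(a, \<one>\<^bsub>G2\<^esub>) \<in> L"
    by (simp add: goursat_K1_def)
  then show "inv\<^bsub>G1\<^esub> a \<in> K1 L"
    using inv_mem[OF a] by (simp add: goursat_K1_def)
  fix b assume "b \<in> K1 L"
  then have "(b, \<one>\<^bsub>G2\<^esub>) \<in> L"
    by (simp add: goursat_K1_def)
  then show "a \<otimes>\<^bsub>G1\<^esub> b \<in> K1 L"
    using mult_mem[OF a] by (fastforce simp: goursat_K1_def)
qed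

lemma subgroup_K2: "subgroup (K2 L) G2"
proof (rule G2.subgroupI)
  show "K2 L \<subseteq> carrier G2"
    using mem_carrier by (auto simp: goursat_K2_def)
  show "K2 L \<noteq> {}"
    using one_mem by (auto simp: goursat_K2_def)
  fix a assume "a \<in> K2 L"
  then have a: "(\<one>\<^bsub>G1\<^esub>, a) \<in> L"
    by (simp add: goursat_K2_def)
  then show "inv\<^bsub>G2\<^esub> a \<in> K2 L"
    using inv_mem[OF a] by (simp add: goursat_K2_def)
  fix b assume "b \<in> K2 L"
  then have "(\<one>\<^bsub>G1\<^esub>, b) \<in> L"
    by (simp add: goursat_K2_def)
  then show "a \<otimes>\<^bsub>G2\<^esub> b \<in> K2 L"
    using mult_mem[OF a] by (fastforce simp: goursat_K2_def)
qed

text \<open>Conjugating (k, 1) by (a, b) inside \<open>L\<close> gives (a k a^-1, 1). Every element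
  of \<open>P1 L\<close> is the first coordinate of such a pair, so this yields normality of
  \<open>K1 L\<close> in \<open>P1 L\<close>.\<close>

lemma conj_mem_K1:
  assumes "(a, b) \<in> L" "k \<in> K1 L"
  shows "a \<otimes>\<^bsub>G1\<^esub> k \<otimes>\<^bsub>G1\<^esub> inv\<^bsub>G1\<^esub> a \<in> K1 L"
  using mult_mem[OF mult_mem[OF assms(1), of k "\<one>\<^bsub>G2\<^esub>"] inv_mem[OF assms(1)]]
    assms mem_carrier by (auto simp: goursat_defs)

lemma conj_mem_K2:
  assumes "(a, b) \<in> L" "k \<in> K2 L"
  shows "b \<otimes>\<^bsub>G2\<^esub> k \<otimes>\<^bsub>G2\<^esub> inv\<^bsub>G2\<^esub> b \<in> K2 L"
  using mult_mem[OF mult_mem[OF assms(1), of "\<one>\<^bsub>G1\<^esub>" k] inv_mem[OF assms(1)]]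
    assms mem_carrier by (auto simp: goursat_defs)

lemma K1_subset_P1: "K1 L \<subseteq> P1 L"
  by (force simp: goursat_defs)

lemma K2_subset_P2: "K2 L \<subseteq> P2 L"
  by (force simp: goursat_defs)

lemma normal_K1: "K1 L \<lhd> G1\<lparr>carrier := P1 L\<rparr>"
proof (rule group.normal_invI)
  show "group (G1\<lparr>carrier := P1 L\<rparr>)"
    by (rule G1.subgroup_imp_group[OF subgroup_P1])
  show "subgroup (K1 L) (G1\<lparr>carrier := P1 L\<rparr>)"
    by (rule G1.subgroup_incl[OF subgroup_K1 subgroup_P1 K1_subset_P1])
qed (use conj_mem_K1 G1.m_inv_consistent[OF subgroup_P1] in \<open>auto simp: goursat_P1_def\<close>)

lemma normal_K2: "K2 L \<lhd> G2\<lparr>carrier := P2 L\<rparr>"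
proof (rule group.normal_invI)
  show "group (G2\<lparr>carrier := P2 L\<rparr>)"
    by (rule G2.subgroup_imp_group[OF subgroup_P2])
  show "subgroup (K2 L) (G2\<lparr>carrier := P2 L\<rparr>)"
    by (rule G2.subgroup_incl[OF subgroup_K2 subgroup_P2 K2_subset_P2])
qed (use conj_mem_K2 G2.m_inv_consistent[OF subgroup_P2] in \<open>auto simp: goursat_P2_def\<close>)

lemma K1_times_K2_subset: "K1 L \<times> K2 L \<subseteq> L"
proof
  fix x assume "x \<in> K1 L \<times> K2 L"
  then obtain a b where x: "x = (a, b)" and ab: "(a, \<one>\<^bsub>G2\<^esub>) \<in> L" "(\<one>\<^bsub>G1\<^esub>, b) \<in> L"
    by (auto simp: goursat_defs)
  show "x \<in> L"
    using mult_mem[OF ab] mem_carrier[OF ab(1)] mem_carrier[OF ab(2)] x by simp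
qed

text \<open>Conjugation by (a, b) acts coordinatewise, so both conjugation lemmas apply. Normality
  is what makes the product of \<open>K1 L \<times> K2 L\<close> with a subgroup of \<open>L\<close>
  a subgroup again.\<close>

lemma normal_K1_times_K2: "K1 L \<times> K2 L \<lhd> (G1 \<times>\<times> G2)\<lparr>carrier := L\<rparr>"
proof (rule group.normal_invI)
  show "group ((G1 \<times>\<times> G2)\<lparr>carrier := L\<rparr>)"
    by (rule G12.subgroup_imp_group[OF L])
  show "subgroup (K1 L \<times> K2 L) ((G1 \<times>\<times> G2)\<lparr>carrier := L\<rparr>)"
    using G12.subgroup_incl[OF _ L K1_times_K2_subset] subgroup_K1 subgroup_K2
      DirProd_subgroups[OF G1.group_axioms _ G2.group_axioms] by blast
qed (use conj_mem_K1 conj_mem_K2 G12.m_inv_consistent[OF L] mem_carrier in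
    \<open>auto simp: inv_DirProd[OF G1.group_axioms G2.group_axioms]\<close>)

text \<open>The first projection maps \<open>L\<close> onto \<open>P1 L\<close>, and its kernel is a
  copy of \<open>K2 L\<close>. A subgroup of \<open>L\<close> that attains both the full image and
  the full kernel is therefore all of \<open>L\<close>.\<close>

lemma nested_subgroup_eqI:
  assumes M: "subgroup M (G1 \<times>\<times> G2)" "M \<subseteq> L" and P: "P1 L \<subseteq> P1 M" and K: "K2 L \<subseteq> K2 M"
  shows "M = L"
proof -
  have "(a, b) \<in> M" if ab: "(a, b) \<in> L" for a b
  proof -
    obtain c where c: "(a, c) \<in> M"
      using P ab by (force simp: goursat_defs)
    then have "(a, c) \<in> L"
      using M by blast
    note carr = mem_carrier[OF ab] mem_carrier[OF this]
    \<comment> \<open>The pairs (a, b) and (a, c) have the same first coordinate, so their quotient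
      lies in the kernel of the first projection, where \<open>K\<close> transfers it to
      \<open>M\<close>.\<close>
    have "(\<one>\<^bsub>G1\<^esub>, b \<otimes>\<^bsub>G2\<^esub> inv\<^bsub>G2\<^esub> c) \<in> L"
      using mult_mem[OF ab inv_mem[OF \<open>(a, c) \<in> L\<close>]] carr by simp
    then have "(\<one>\<^bsub>G1\<^esub>, b \<otimes>\<^bsub>G2\<^esub> inv\<^bsub>G2\<^esub> c) \<in> M"
      using K by (auto simp: goursat_defs)
    then have "(\<one>\<^bsub>G1\<^esub> \<otimes>\<^bsub>G1\<^esub> a, b \<otimes>\<^bsub>G2\<^esub> inv\<^bsub>G2\<^esub> c \<otimes>\<^bsub>G2\<^esub> c) \<in> M"
      using subgroup.m_closed[OF M(1) _ c] by fastforce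
    then show ?thesis
      using carr by (simp add: G2.m_assoc)
  qed
  then show ?thesis
    using M by auto
qed

end

section \<open>The relations as conditions on projections and kernels\<close>

lemma sub_le_iff:
  "(L', L) \<in> sub_le G1 G2 \<longleftrightarrow> subgroup L' (G1 \<times>\<times> G2) \<and> subgroup L (G1 \<times>\<times> G2) \<and> L' \<subseteq> L"
  by (auto simp: sub_le_def subgroups_of_def)

lemma sub_le_trans:
  "(L, M) \<in> sub_le G1 G2 \<Longrightarrow> (M, N) \<in> sub_le G1 G2 \<Longrightarrow> (L, N) \<in> sub_le G1 G2"
  by (auto simp: sub_le_iff)

lemma sub_le_P_iff:
  "(L', L) \<in> sub_le_P G1 G2 \<longleftrightarrow> (L', L) \<in> sub_le G1 G2 \<and> P1 L' = P1 L \<and> P2 L' = P2 L"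
  by (auto simp: sub_le_P_def)

lemma sub_le_K_iff:
  "(L', L) \<in> sub_le_K G1 G2 \<longleftrightarrow> (L', L) \<in> sub_le G1 G2 \<and> K1 L' = K1 L \<and> K2 L' = K2 L"
  by (auto simp: sub_le_K_def)

lemma goursat_mono:
  assumes "L' \<subseteq> L"
  shows "P1 L' \<subseteq> P1 L" "P2 L' \<subseteq> P2 L" "K1 L' \<subseteq> K1 L" "K2 L' \<subseteq> K2 L"
  using assms by (auto simp: goursat_defs)

text \<open>This is the isomorphism criterion in both factors. It replaces the quotient groups by
  inclusions of sets, the only form used afterwards.\<close>

lemma sub_le_PK_iff:
  "(L', L) \<in> sub_le_PK G1 G2 \<longleftrightarrow> (L', L) \<in> sub_le G1 G2 \<and>
     P1 L' \<inter> K1 L \<subseteq> K1 L' \<and> P1 L \<subseteq> K1 L <#>\<^bsub>G1\<^esub> P1 L' \<and>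
     P2 L' \<inter> K2 L \<subseteq> K2 L' \<and> P2 L \<subseteq> K2 L <#>\<^bsub>G2\<^esub> P2 L'"
proof (cases "(L', L) \<in> sub_le G1 G2")
  case True
  then have *: "subgroup L' (G1 \<times>\<times> G2)" "subgroup L (G1 \<times>\<times> G2)" "L' \<subseteq> L"
    by (auto simp: sub_le_iff)
  note mono = goursat_mono[OF *(3)]
  show ?thesis
    using True
      G1.canonical_section_map_iso_iff[OF subgroup_P1[OF *(1)] subgroup_P1[OF *(2)] mono(1)
        normal_K1[OF *(1)] normal_K1[OF *(2)] mono(3)]
      G2.canonical_section_map_iso_iff[OF subgroup_P2[OF *(1)] subgroup_P2[OF *(2)] mono(2)
        normal_K2[OF *(1)] normal_K2[OF *(2)] mono(4)]
    by (auto simp: sub_le_PK_def)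
qed (auto simp: sub_le_PK_def)

section \<open>The intermediate subgroups\<close>

text \<open>The candidate for N. The kernels stand on the left, as in the set products of
  \<open>sub_le_PK_iff\<close>, so its projections have the required shape without exchanging
  factors.\<close>

definition upper :: "('a \<times> 'b) set \<Rightarrow> ('a \<times> 'b) set \<Rightarrow> ('a \<times> 'b) set" where
  "upper L' L = (K1 L \<times> K2 L) <#>\<^bsub>G1 \<times>\<times> G2\<^esub> L'"

text \<open>The candidate for M: the part of N whose coordinates stay in the projections of
  \<open>L'\<close>.\<close>

definition lower :: "('a \<times> 'b) set \<Rightarrow> ('a \<times> 'b) set \<Rightarrow> ('a \<times> 'b) set" where
  "lower L' L = upper L' L \<inter> (P1 L' \<times> P2 L')"

lemma mem_upper_iff:
  "x \<in> upper L' L \<longleftrightarrow> (\<exists>h\<in>K1 L. \<exists>k\<in>K2 L. \<exists>(a, b)\<in>L'. x = (h \<otimes>\<^bsub>G1\<^esub> a, k \<otimes>\<^bsub>G2\<^esub> b))"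
  by (simp add: upper_def set_mult_def mult_DirProd' case_prod_unfold Bex_def)

context
  fixes L' L assumes le: "(L', L) \<in> sub_le G1 G2"
begin

private lemma L': "subgroup L' (G1 \<times>\<times> G2)" and L: "subgroup L (G1 \<times>\<times> G2)" and L'_L: "L' \<subseteq> L"
  using le by (auto simp: sub_le_iff)

text \<open>Inside \<open>L\<close>, this is the product of the normal subgroup
  \<open>K1 L \<times> K2 L\<close> with the subgroup \<open>L'\<close>.\<close>

lemma subgroup_upper: "subgroup (upper L' L) (G1 \<times>\<times> G2)" and upper_subset: "upper L' L \<subseteq> L"
proof -
  have "subgroup (upper L' L) ((G1 \<times>\<times> G2)\<lparr>carrier := L\<rparr>)"
    unfolding upper_def
    using G12.mult_norm_sub_in_sub[OF normal_K1_times_K2[OF L] G12.subgroup_incl[OF L' L L'_L] L]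
    by simp
  then show "subgroup (upper L' L) (G1 \<times>\<times> G2)" "upper L' L \<subseteq> L"
    using G12.incl_subgroup[OF L] subgroup.subset by force+
qed

lemma subset_upper: "L' \<subseteq> upper L' L"
proof
  fix x assume x: "x \<in> L'"
  then show "x \<in> upper L' L"
    unfolding mem_upper_iff
    using subgroup.one_closed[OF subgroup_K1[OF L]] subgroup.one_closed[OF subgroup_K2[OF L]]
      mem_carrier[OF L'] by (intro bexI[of _ "\<one>\<^bsub>G1\<^esub>"] bexI[of _ "\<one>\<^bsub>G2\<^esub>"] bexI[of _ x]) auto
qed

lemma P1_upper: "P1 (upper L' L) = K1 L <#>\<^bsub>G1\<^esub> P1 L'"
proof
  show "P1 (upper L' L) \<subseteq> K1 L <#>\<^bsub>G1\<^esub> P1 L'"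
    by (force simp: goursat_P1_def set_mult_def mem_upper_iff)
  have "h \<otimes>\<^bsub>G1\<^esub> a \<in> P1 (upper L' L)" if "h \<in> K1 L" "(a, b) \<in> L'" for h a b
  proof -
    \<comment> \<open>Taking the identity as the element of \<open>K2 L\<close> lifts h a to a pair
      in \<open>upper L' L\<close>.\<close>
    have "(h \<otimes>\<^bsub>G1\<^esub> a, \<one>\<^bsub>G2\<^esub> \<otimes>\<^bsub>G2\<^esub> b) \<in> upper L' L"
      unfolding mem_upper_iff using that subgroup.one_closed[OF subgroup_K2[OF L]] by blast
    then show ?thesis
      by (force simp: goursat_P1_def)
  qed
  then show "K1 L <#>\<^bsub>G1\<^esub> P1 L' \<subseteq> P1 (upper L' L)"
    by (auto simp: goursat_P1_def[of L'] set_mult_def)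
qed

lemma P2_upper: "P2 (upper L' L) = K2 L <#>\<^bsub>G2\<^esub> P2 L'"
proof
  show "P2 (upper L' L) \<subseteq> K2 L <#>\<^bsub>G2\<^esub> P2 L'"
    by (force simp: goursat_P2_def set_mult_def mem_upper_iff)
  have "h \<otimes>\<^bsub>G2\<^esub> b \<in> P2 (upper L' L)" if "h \<in> K2 L" "(a, b) \<in> L'" for h a b
  proof -
    have "(\<one>\<^bsub>G1\<^esub> \<otimes>\<^bsub>G1\<^esub> a, h \<otimes>\<^bsub>G2\<^esub> b) \<in> upper L' L"
      unfolding mem_upper_iff using that subgroup.one_closed[OF subgroup_K1[OF L]] by blast
    then show ?thesis
      by (force simp: goursat_P2_def)
  qed
  then show "K2 L <#>\<^bsub>G2\<^esub> P2 L' \<subseteq> P2 (upper L' L)"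
    by (auto simp: goursat_P2_def[of L'] set_mult_def)
qed

lemma K1_times_K2_subset_upper: "K1 L \<times> K2 L \<subseteq> upper L' L"
proof clarify
  fix h k assume hk: "h \<in> K1 L" "k \<in> K2 L"
  then have "h \<in> carrier G1" "k \<in> carrier G2"
    using subgroup.mem_carrier[OF subgroup_K1[OF L]] subgroup.mem_carrier[OF subgroup_K2[OF L]]
    by auto
  then show "(h, k) \<in> upper L' L"
    unfolding mem_upper_iff
    using hk one_mem[OF L'] by (intro bexI[of _ h] bexI[of _ k] bexI[OF _ one_mem[OF L']]) auto
qed

text \<open>The kernels are squeezed, since \<open>upper L' L\<close> lies between
  \<open>K1 L \<times> K2 L\<close> and \<open>L\<close>.\<close>

lemma K1_upper: "K1 (upper L' L) = K1 L" and K2_upper: "K2 (upper L' L) = K2 L"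
proof -
  have "K1 L \<subseteq> K1 (upper L' L)" "K2 L \<subseteq> K2 (upper L' L)"
    using K1_times_K2_subset_upper
      subgroup.one_closed[OF subgroup_K1[OF L]] subgroup.one_closed[OF subgroup_K2[OF L]]
    by (auto simp: goursat_K1_def[of G2 "upper L' L"] goursat_K2_def[of G1 "upper L' L"])
  then show "K1 (upper L' L) = K1 L" "K2 (upper L' L) = K2 L"
    using goursat_mono[OF upper_subset] by auto
qed

lemma subgroup_lower: "subgroup (lower L' L) (G1 \<times>\<times> G2)"
  unfolding lower_def
  by (intro G12.subgroups_Inter_pair subgroup_upper
      DirProd_subgroups[OF G1.group_axioms subgroup_P1[OF L'] G2.group_axioms subgroup_P2[OF L']])

lemma subset_lower: "L' \<subseteq> lower L' L"
  using subset_upper by (force simp: lower_def goursat_defs)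

text \<open>The projections are squeezed, since \<open>lower L' L\<close> lies between
  \<open>L'\<close> and \<open>P1 L' \<times> P2 L'\<close>.\<close>

lemma P1_lower: "P1 (lower L' L) = P1 L'" and P2_lower: "P2 (lower L' L) = P2 L'"
proof -
  have "lower L' L \<subseteq> P1 L' \<times> P2 L'"
    by (simp add: lower_def)
  then have "P1 (lower L' L) \<subseteq> P1 L'" "P2 (lower L' L) \<subseteq> P2 L'"
    by (auto simp: goursat_P1_def[of "lower L' L"] goursat_P2_def[of "lower L' L"])
  then show "P1 (lower L' L) = P1 L'" "P2 (lower L' L) = P2 L'"
    using goursat_mono[OF subset_lower] by auto
qed

text \<open>A pair (a, 1) lies in \<open>upper L' L\<close> iff a is in \<open>K1 L\<close>, by
  \<open>K1_upper\<close>; it lies in the box of projections iff a is in \<open>P1 L'\<close>,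
  because \<open>P2 L'\<close> contains 1. The other factor is symmetric.\<close>

lemma K1_lower: "K1 (lower L' L) = P1 L' \<inter> K1 L" and K2_lower: "K2 (lower L' L) = P2 L' \<inter> K2 L"
  using K1_upper K2_upper
    subgroup.one_closed[OF subgroup_P1[OF L']] subgroup.one_closed[OF subgroup_P2[OF L']]
  by (auto simp: lower_def goursat_K1_def goursat_K2_def set_eq_iff)

text \<open>The projections and kernels computed above satisfy each relation; the inclusions
  demanded in the middle step even hold as equalities.\<close>

lemma factorization:
  "(L', lower L' L) \<in> sub_le_P G1 G2" "(lower L' L, upper L' L) \<in> sub_le_PK G1 G2"
  "(upper L' L, L) \<in> sub_le_K G1 G2"
proof -
  show "(L', lower L' L) \<in> sub_le_P G1 G2"
    using L' subgroup_lower subset_lower by (simp add: sub_le_P_iff sub_le_iff P1_lower P2_lower)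
  have "lower L' L \<subseteq> upper L' L"
    by (simp add: lower_def)
  then show "(lower L' L, upper L' L) \<in> sub_le_PK G1 G2"
    using subgroup_lower subgroup_upper
    by (simp add: sub_le_PK_iff sub_le_iff P1_lower P2_lower K1_lower K2_lower
        P1_upper P2_upper K1_upper K2_upper)
  show "(upper L' L, L) \<in> sub_le_K G1 G2"
    using L subgroup_upper upper_subset by (simp add: sub_le_K_iff sub_le_iff K1_upper K2_upper)
qed

end

section \<open>Uniqueness of the chain\<close>

text \<open>Any N contains \<open>upper L' L\<close> and any M is contained in
  \<open>lower L' L\<close>. Both inclusions become equalities by
  \<open>nested_subgroup_eqI\<close>.\<close>

lemma factorization_unique:
  assumes P: "(L', M) \<in> sub_le_P G1 G2" and PK: "(M, N) \<in> sub_le_PK G1 G2"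
    and K: "(N, L) \<in> sub_le_K G1 G2"
  shows "N = upper L' L" "M = lower L' L"
proof -
  have "(L', M) \<in> sub_le G1 G2" "(M, N) \<in> sub_le G1 G2" "(N, L) \<in> sub_le G1 G2"
    using assms by (simp_all add: sub_le_P_iff sub_le_PK_iff sub_le_K_iff)
  then have le: "(L', L) \<in> sub_le G1 G2"
    by (blast intro: sub_le_trans)
  have M: "subgroup M (G1 \<times>\<times> G2)" "L' \<subseteq> M" "M \<subseteq> N" "P1 M = P1 L'" "P2 M = P2 L'"
    and N: "subgroup N (G1 \<times>\<times> G2)" "K1 N = K1 L" "K2 N = K2 L"
    using assms by (auto simp: sub_le_P_iff sub_le_PK_iff sub_le_K_iff sub_le_iff)
  have "upper L' L \<subseteq> N"
  proof -
    have "(h \<otimes>\<^bsub>G1\<^esub> a, k \<otimes>\<^bsub>G2\<^esub> b) \<in> N"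
      if "h \<in> K1 L" "k \<in> K2 L" "(a, b) \<in> L'" for h k a b
      using that K1_times_K2_subset[OF N(1)] N(2,3) M(2,3) by (intro mult_mem[OF N(1)]) auto
    then show ?thesis
      by (auto simp: mem_upper_iff)
  qed
  \<comment> \<open>Surjectivity in the first factor gives \<open>P1 N\<close> inside
    \<open>K1 N\<close> times \<open>P1 M\<close>, that is, \<open>K1 L\<close> times
    \<open>P1 L'\<close>.\<close>
  moreover have "P1 N \<subseteq> P1 (upper L' L)"
    using PK M N by (simp add: sub_le_PK_iff P1_upper[OF le])
  ultimately show eq: "N = upper L' L"
    using nested_subgroup_eqI[OF N(1) subgroup_upper[OF le]] N(3) K2_upper[OF le] by simp
  have "M \<subseteq> P1 L' \<times> P2 L'"
    unfolding M(4,5)[symmetric] by (force simp: goursat_P1_def goursat_P2_def)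
  then have "M \<subseteq> lower L' L"
    using M(3) eq by (auto simp: lower_def)
  \<comment> \<open>Injectivity in the second factor: \<open>K2 (lower L' L)\<close> is
    \<open>P2 L' \<inter> K2 L\<close>, which equals \<open>P2 M \<inter> K2 N\<close>.\<close>
  moreover have "K2 (lower L' L) \<subseteq> K2 M"
    using PK M N by (simp add: sub_le_PK_iff K2_lower[OF le])
  ultimately show "M = lower L' L"
    using nested_subgroup_eqI[OF subgroup_lower[OF le] M(1)] P1_lower[OF le] M(4) by simp
qed

section \<open>Products of relations and of incidence matrices\<close>

text \<open>Existence of the chain gives one inclusion, transitivity the other. The bracketing is
  that of the left-associated \<open>\<circ>\<^sub>R\<close> and of the left-associated matrix
  product, with the order of factors reversed by \<open>O\<close>.\<close>

lemma sub_le_eq_relcomp: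
  "sub_le G1 G2 = sub_le_P G1 G2 O (sub_le_PK G1 G2 O sub_le_K G1 G2)"
proof
  show "sub_le G1 G2 \<subseteq> sub_le_P G1 G2 O (sub_le_PK G1 G2 O sub_le_K G1 G2)"
    using factorization by fast
  show "sub_le_P G1 G2 O (sub_le_PK G1 G2 O sub_le_K G1 G2) \<subseteq> sub_le G1 G2"
    by (auto simp: sub_le_P_iff sub_le_PK_iff sub_le_K_iff sub_le_iff) blast
qed

lemma incidence_matrix_sub_le:
  assumes "distinct xs" "set xs = subgroups_of (G1 \<times>\<times> G2)"
  shows "incidence_matrix xs (sub_le G1 G2) =
    incidence_matrix xs (sub_le_K G1 G2) * incidence_matrix xs (sub_le_PK G1 G2) *
    incidence_matrix xs (sub_le_P G1 G2)"
proof -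
  have mem: "M \<in> set xs" if "(M, L) \<in> sub_le G1 G2" for M L
    using that assms by (auto simp: sub_le_def)
  \<comment> \<open>Prefixing the trivial step from M to itself turns a two-step chain into a
    three-step one, so \<open>factorization_unique\<close> also determines the middle element N of
    the first matrix product.\<close>
  have refl: "(M, M) \<in> sub_le_P G1 G2" if "(M, N) \<in> sub_le_PK G1 G2" for M N
    using that by (auto simp: sub_le_PK_iff sub_le_P_iff sub_le_iff)
  have "incidence_matrix xs (sub_le_K G1 G2) * incidence_matrix xs (sub_le_PK G1 G2) =
      incidence_matrix xs (sub_le_PK G1 G2 O sub_le_K G1 G2)"
  proof (rule incidence_matrix_relcomp[OF assms(1)])
    show "N \<in> set xs" if "(N, L) \<in> sub_le_K G1 G2" for N L
      using that mem by (auto simp: sub_le_K_iff)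
  qed (metis refl factorization_unique(1))
  also have "\<dots> * incidence_matrix xs (sub_le_P G1 G2) =
      incidence_matrix xs (sub_le_P G1 G2 O (sub_le_PK G1 G2 O sub_le_K G1 G2))"
  proof (rule incidence_matrix_relcomp[OF assms(1)])
    show "M \<in> set xs" if "(M, L) \<in> sub_le_PK G1 G2 O sub_le_K G1 G2" for M L
      using that mem by (auto simp: sub_le_PK_iff)
  \<comment> \<open>Here the middle element is M, which is determined by the two ends whatever N is
    hidden in the inner composition.\<close>
  qed (use factorization_unique(2) in blast)
  finally show ?thesis
    by (simp add: sub_le_eq_relcomp)
qed

end

theorem corollary5p7:
  fixes G1 :: "('a, 'm) monoid_scheme" and G2 :: "('b, 'n) monoid_scheme"
  assumes "group G1" and "finite (carrier G1)"
    and "group G2" and "finite (carrier G2)"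
  shows "sub_le G1 G2 = sub_le_K G1 G2 \<circ>\<^sub>R sub_le_PK G1 G2 \<circ>\<^sub>R sub_le_P G1 G2 \<and>
    (\<forall>xs. distinct xs \<and> set xs = subgroups_of (G1 \<times>\<times> G2) \<longrightarrow>
       incidence_matrix xs (sub_le G1 G2) =
         incidence_matrix xs (sub_le_K G1 G2) *
         incidence_matrix xs (sub_le_PK G1 G2) *
         incidence_matrix xs (sub_le_P G1 G2))"
proof -
  interpret group_pair G1 G2
    using assms by (simp add: group_pair_def)
  show ?thesis
    using sub_le_eq_relcomp incidence_matrix_sub_le by (simp add: rel_product_def)
qed

end
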